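(* Let $\rho\in L^1(\mathbb{R}^d)$ be a nonnegative function and let $\mathbb{L}$ be the associated operator, $$-\mathbb{L}\mathbf{u}(x)=\int_{\mathbb{R}^d}\left(\frac{y\otimes y}{|y|^2}\right)\left(\mathbf{u}(x+y)-\mathbf{u}(x)\right)\rho(y)\,dy .$$ Then for every $\lambda>0$ and every $\mathbf{f}\in[L^2(\mathbb{R}^d)]^d$ there exists a unique strong solution $\mathbf{u}\in[L^2(\mathbb{R}^d)]^d$ of $$\mathbb{L}\mathbf{u}+\lambda\mathbf{u}=\mathbf{f}\quad\text{in }\mathbb{R}^d,$$ and it satisfies $$\lambda\|\mathbf{u}\|_{L^2}\le C\|\mathbf{f}\|_{L^2},$$ where $C=C(d,\rho)>0$.
   Context: Vector fields are $\mathbb{R}^d$-valued. $y\otimes y$ is the matrix with entries $y_iy_j$. No symmetry of $\rho$ is assumed. A strong solution satisfies the equation almost everywhere. *)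

theory Defs
  imports "HOL-Analysis.Analysis"
begin

text \<open>Dimension $d$ is \<open>CARD('n)\<close>. Elements of $[L^2]^d$ are represented by
  Lebesgue measurable functions; equality in $L^2$ is equality almost everywhere.\<close>

definition square_integrable :: "(real^'n \<Rightarrow> real^'n) \<Rightarrow> bool" where
  "square_integrable u \<longleftrightarrow>
     u \<in> borel_measurable lebesgue \<and> integrable lebesgue (\<lambda>x. (norm (u x))\<^sup>2)"

definition L2_norm :: "(real^'n \<Rightarrow> real^'n) \<Rightarrow> real" where
  "L2_norm u = sqrt (LINT x|lebesgue. (norm (u x))\<^sup>2)"

definition outer :: "real^'n \<Rightarrow> real^'n^'n" where
  "outer y = (\<chi> i j. y $ i * y $ j)"

text \<open>At \<open>y = 0\<close> the matrix below is \<open>0\<close> by the convention \<open>x / 0 = 0\<close>; this is a null set.\<close>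

definition op_integrand ::
  "(real^'n \<Rightarrow> real) \<Rightarrow> (real^'n \<Rightarrow> real^'n) \<Rightarrow> real^'n \<Rightarrow> real^'n \<Rightarrow> real^'n" where
  "op_integrand \<rho> u x y =
     \<rho> y *\<^sub>R (((1 / (norm y)\<^sup>2) *\<^sub>R outer y) *v (u (x + y) - u x))"

definition op_L ::
  "(real^'n \<Rightarrow> real) \<Rightarrow> (real^'n \<Rightarrow> real^'n) \<Rightarrow> real^'n \<Rightarrow> real^'n" where
  "op_L \<rho> u x = - (LINT y|lebesgue. op_integrand \<rho> u x y)"

text \<open>The equation is required to hold, with an absolutely convergent integral, at almost every
  point. The explicit integrability condition excludes points where the Bochner integral is \<open>0\<close>
  only by convention.\<close>

definition strong_solution ::
  "(real^'n \<Rightarrow> real) \<Rightarrow> real \<Rightarrow> (real^'n \<Rightarrow> real^'n) \<Rightarrow> (real^'n \<Rightarrow> real^'n) \<Rightarrow> bool" where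
  "strong_solution \<rho> lam f u \<longleftrightarrow>
     (AE x in lebesgue. integrable lebesgue (op_integrand \<rho> u x) \<and>
        op_L \<rho> u x + lam *\<^sub>R u x = f x)"

end

theory Submission
  imports Defs
begin

text \<open>Write \<open>P\<^sub>y\<close> for the orthogonal projection onto the line through \<open>y\<close>, which is
  multiplication by the matrix $y\otimes y/|y|^2$, and \<open>m\<close> for the integral of \<open>\<rho>\<close>. Adding
  and subtracting \<open>m u(x)\<close> turns $\mathbb{L}u + \lambda u = f$ into
  \<open>(\<lambda> + m) u = J u + f\<close>, where
  \<open>J u(x) = \<integral> \<rho>(y) (u(x) + P\<^sub>y (u(x + y) - u(x))) dy\<close>.

  The point is that for every fixed \<open>y\<close> the map
  \<open>u \<mapsto> u(x) + P\<^sub>y (u(x + y) - u(x)) = (1 - P\<^sub>y) u(x) + P\<^sub>y u(x + y)\<close> preserves the \<open>L\<^sup>2\<close> norm: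
  it keeps the component of \<open>u\<close> orthogonal to \<open>y\<close> and translates the component along \<open>y\<close>; the two
  are orthogonal at every point, and translation preserves Lebesgue measure
  (\<open>nn_integral_exchange_sq\<close>). So \<open>J\<close> is a \<open>\<rho>\<close>-weighted superposition of isometries and has norm at
  most \<open>m\<close> (\<open>average_contraction\<close>). Hence \<open>(\<lambda> + m) u = J u + f\<close> is a
  fixed point equation for a contraction with factor \<open>m / (\<lambda> + m) < 1\<close>: a Neumann series solves
  it (\<open>resolvent_exists\<close>), and
  \<open>(\<lambda> + m) \<parallel>u\<parallel> \<le> m \<parallel>u\<parallel> + \<parallel>f\<parallel>\<close> gives \<open>\<lambda> \<parallel>u\<parallel> \<le> \<parallel>f\<parallel>\<close> (\<open>a_priori_estimate\<close>), which yields
  the bound with \<open>C = 1\<close> and, by linearity, uniqueness.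

  Tonelli's theorem needs joint measurability in \<open>(x, y)\<close>, which fails to be automatic for Lebesgue
  measurable functions. The analysis is therefore done for Borel functions, and
  \<open>strong_solution_iff_average\<close> transfers the equation to Borel representatives of \<open>\<rho>\<close>, \<open>u\<close>
  and \<open>f\<close>.\<close>

section \<open>Exchanging the component along a direction\<close>

definition line_proj :: "'a::real_inner \<Rightarrow> 'a \<Rightarrow> 'a" where
  "line_proj y v = ((y \<bullet> v) / (norm y)\<^sup>2) *\<^sub>R y"

definition exchange :: "('a::real_inner \<Rightarrow> 'a) \<Rightarrow> 'a \<Rightarrow> 'a \<Rightarrow> 'a" where
  "exchange w x y = w x + line_proj y (w (x + y) - w x)"

lemma line_proj_pythagoras:
  "(norm (v - line_proj y v))\<^sup>2 + (norm (line_proj y v))\<^sup>2 = (norm v)\<^sup>2"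
proof -
  have "line_proj y v \<bullet> line_proj y v = line_proj y v \<bullet> v"
    by (cases "y = 0") (simp_all add: line_proj_def power2_norm_eq_inner)
  then show ?thesis
    by (simp add: power2_norm_eq_inner inner_diff_left inner_diff_right inner_commute)
qed

lemma norm_line_proj_le: "norm (line_proj y v) \<le> norm v"
proof -
  have "(norm (line_proj y v))\<^sup>2 \<le> (norm v)\<^sup>2"
    using line_proj_pythagoras[of v y] zero_le_power2[of "norm (v - line_proj y v)"] by linarith
  then show ?thesis by (simp add: power2_le_iff_abs_le)
qed

lemma bounded_linear_line_proj: "bounded_linear (line_proj y)"
proof (rule bounded_linear_intro[where K=1])
  show "norm (line_proj y v) \<le> norm v * 1" for v
    by (simp add: norm_line_proj_le)
qed (simp_all add: line_proj_def inner_add_right add_divide_distrib scaleR_add_left)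

text \<open>Rewriting \<open>exchange w x y\<close> as \<open>(1 - P) (w x) + P (w (x + y))\<close>, with \<open>P\<close> the projection onto
  the line through \<open>y\<close>, exhibits it as a sum of orthogonal vectors.\<close>

lemma norm_exchange_sq:
  "(norm (exchange w x y))\<^sup>2
     = (norm (w x - line_proj y (w x)))\<^sup>2 + (norm (line_proj y (w (x + y))))\<^sup>2"
proof -
  have diff: "line_proj y (w (x + y) - w x) = line_proj y (w (x + y)) - line_proj y (w x)"
    by (rule linear_diff[OF bounded_linear.linear[OF bounded_linear_line_proj]])
  have "y \<bullet> (w x - line_proj y (w x)) = 0"
    by (cases "y = 0") (simp_all add: line_proj_def inner_diff_right power2_norm_eq_inner)
  then have "(w x - line_proj y (w x)) \<bullet> line_proj y (w (x + y)) = 0"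
    by (simp add: line_proj_def inner_commute)
  moreover have "exchange w x y = (w x - line_proj y (w x)) + line_proj y (w (x + y))"
    by (simp add: exchange_def diff)
  ultimately show ?thesis
    by (metis norm_add_Pythagorean orthogonal_def)
qed

text \<open>A pointwise majorant without the projection, used to dominate series under the integral.\<close>

lemma norm_exchange_le: "norm (exchange w x y) \<le> 2 * norm (w x) + norm (w (x + y))"
proof -
  have "norm (exchange w x y) \<le> norm (w x) + norm (w (x + y) - w x)"
    unfolding exchange_def
    by (rule order_trans[OF norm_triangle_ineq]) (simp add: norm_line_proj_le)
  then show ?thesis
    using norm_triangle_ineq4[of "w (x + y)" "w x"] by linarith
qed

lemma exchange_diff:
  "exchange (\<lambda>x. v x - w x) x y = exchange v x y - exchange w x y"
  unfolding exchange_def linear_diff[OF bounded_linear.linear[OF bounded_linear_line_proj]]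
  by simp

lemma line_proj_measurable [measurable]:
  fixes f g :: "'b \<Rightarrow> 'a::euclidean_space"
  assumes [measurable]: "f \<in> borel_measurable M" "g \<in> borel_measurable M"
  shows "(\<lambda>z. line_proj (f z) (g z)) \<in> borel_measurable M"
  unfolding line_proj_def by measurable

lemma exchange_measurable [measurable]:
  fixes w :: "'a::euclidean_space \<Rightarrow> 'a"
  assumes [measurable]: "w \<in> borel_measurable borel" "f \<in> borel_measurable M" "g \<in> borel_measurable M"
  shows "(\<lambda>z. exchange w (f z) (g z)) \<in> borel_measurable M"
  unfolding exchange_def by measurable

lemma nn_integral_lborel_translate:
  fixes \<phi> :: "'a::euclidean_space \<Rightarrow> ennreal"
  assumes [measurable]: "\<phi> \<in> borel_measurable borel"
  shows "(\<integral>\<^sup>+x. \<phi> (x + y) \<partial>lborel) = (\<integral>\<^sup>+x. \<phi> x \<partial>lborel)"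
proof -
  have "(\<integral>\<^sup>+x. \<phi> x \<partial>lborel) = (\<integral>\<^sup>+x. \<phi> x \<partial>distr lborel borel ((+) y))"
    by (simp add: lborel_distr_plus)
  also have "\<dots> = (\<integral>\<^sup>+x. \<phi> (x + y) \<partial>lborel)"
    by (subst nn_integral_distr) (auto simp: add.commute)
  finally show ?thesis ..
qed

lemma AE_lborel_translate:
  fixes x :: "'a::euclidean_space"
  assumes "AE z in lborel. P z"
  shows "AE y in lborel. P (x + y)"
proof (rule AE_distrD[where f = "(+) x" and P = P])
  show "(+) x \<in> lborel \<rightarrow>\<^sub>M borel" by measurable
  show "AE z in distr lborel borel ((+) x). P z"
    unfolding lborel_distr_plus by (rule assms)
qed

text \<open>Of the two orthogonal components of \<open>exchange w x y\<close>, the one orthogonal to \<open>y\<close> is taken at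
  \<open>x\<close> and the one along \<open>y\<close> at \<open>x + y\<close>. After integration in \<open>x\<close> the translation disappears and
  the components recombine by Pythagoras.\<close>

lemma nn_integral_exchange_sq:
  fixes w :: "'a::euclidean_space \<Rightarrow> 'a"
  assumes [measurable]: "w \<in> borel_measurable borel"
  shows "(\<integral>\<^sup>+x. ennreal ((norm (exchange w x y))\<^sup>2) \<partial>lborel) = (\<integral>\<^sup>+x. ennreal ((norm (w x))\<^sup>2) \<partial>lborel)"
proof -
  let ?p = "\<lambda>x. ennreal ((norm (w x - line_proj y (w x)))\<^sup>2)"
  let ?q = "\<lambda>x. ennreal ((norm (line_proj y (w x)))\<^sup>2)"
  have "(\<integral>\<^sup>+x. ennreal ((norm (exchange w x y))\<^sup>2) \<partial>lborel)
      = (\<integral>\<^sup>+x. ?p x + ?q (x + y) \<partial>lborel)"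
    by (simp add: norm_exchange_sq)
  also have "\<dots> = (\<integral>\<^sup>+x. ?p x \<partial>lborel) + (\<integral>\<^sup>+x. ?q (x + y) \<partial>lborel)"
    by (rule nn_integral_add) measurable
  also have "(\<integral>\<^sup>+x. ?q (x + y) \<partial>lborel) = (\<integral>\<^sup>+x. ?q x \<partial>lborel)"
    by (rule nn_integral_lborel_translate) measurable
  also have "(\<integral>\<^sup>+x. ?p x \<partial>lborel) + (\<integral>\<^sup>+x. ?q x \<partial>lborel) = (\<integral>\<^sup>+x. ?p x + ?q x \<partial>lborel)"
    by (rule nn_integral_add[symmetric]) measurable
  also have "\<dots> = (\<integral>\<^sup>+x. ennreal ((norm (w x))\<^sup>2) \<partial>lborel)"
    by (simp add: line_proj_pythagoras flip: ennreal_plus)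
  finally show ?thesis .
qed

section \<open>The averaging operator of a nonnegative kernel\<close>

text \<open>Borel, not Lebesgue, measurability: it makes \<open>(x, y) \<mapsto> w (x + y)\<close> jointly measurable.\<close>

definition borel_L2 :: "('a::euclidean_space \<Rightarrow> 'b::euclidean_space) \<Rightarrow> bool" where
  "borel_L2 w \<longleftrightarrow> w \<in> borel_measurable borel \<and> integrable lborel (\<lambda>x. (norm (w x))\<^sup>2)"

lemma borel_L2_dominated:
  assumes w: "w \<in> borel_measurable borel" and h: "borel_L2 h"
    and le: "AE x in lborel. norm (w x) \<le> c * norm (h x)"
  shows "borel_L2 w"
  unfolding borel_L2_def
proof
  note [measurable] = w
  have "integrable lborel (\<lambda>x. c\<^sup>2 * (norm (h x))\<^sup>2)"
    using h by (simp add: borel_L2_def)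
  then show "integrable lborel (\<lambda>x. (norm (w x))\<^sup>2)"
  proof (rule Bochner_Integration.integrable_bound)
    show "AE x in lborel. norm ((norm (w x))\<^sup>2) \<le> norm (c\<^sup>2 * (norm (h x))\<^sup>2)"
      using le by eventually_elim (simp add: power_mono flip: power_mult_distrib)
  qed measurable
qed fact

lemma borel_L2_diff:
  assumes "borel_L2 v" "borel_L2 w"
  shows "borel_L2 (\<lambda>x. v x - w x)"
proof -
  have [measurable]: "v \<in> borel_measurable borel" "w \<in> borel_measurable borel"
    using assms by (simp_all add: borel_L2_def)
  have "integrable lborel (\<lambda>x. 2 * (norm (v x))\<^sup>2 + 2 * (norm (w x))\<^sup>2)"
    using assms by (simp add: borel_L2_def)
  then have "integrable lborel (\<lambda>x. (norm (v x - w x))\<^sup>2)"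
  proof (rule Bochner_Integration.integrable_bound)
    have "(norm (a - b))\<^sup>2 \<le> 2 * (norm a)\<^sup>2 + 2 * (norm b)\<^sup>2" for a b :: 'b
      using inner_ge_zero[of "a + b"]
      by (simp add: power2_norm_eq_inner inner_add_left inner_add_right inner_diff_left inner_diff_right inner_commute)
    then show "AE x in lborel. norm ((norm (v x - w x))\<^sup>2) \<le> norm (2 * (norm (v x))\<^sup>2 + 2 * (norm (w x))\<^sup>2)"
      by simp
  qed measurable
  then show ?thesis by (simp add: borel_L2_def)
qed

lemma le_one_plus_square: "a \<le> 1 + a\<^sup>2" for a :: real
  using sum_power2_ge_zero[of "a - 1" a] by (simp add: power2_eq_square algebra_simps)

locale nonneg_kernel =
  fixes \<rho> :: "'a::euclidean_space \<Rightarrow> real"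
  assumes kernel_measurable [measurable]: "\<rho> \<in> borel_measurable borel"
    and kernel_nonneg: "0 \<le> \<rho> y"
    and kernel_integrable: "integrable lborel \<rho>"
begin

definition mass :: real where
  "mass = (LINT y|lborel. \<rho> y)"

definition average :: "('a \<Rightarrow> 'a) \<Rightarrow> 'a \<Rightarrow> 'a" where
  "average w x = (LINT y|lborel. \<rho> y *\<^sub>R exchange w x y)"

definition energy :: "('a \<Rightarrow> 'a) \<Rightarrow> 'a \<Rightarrow> real" where
  "energy w x = (LINT y|lborel. \<rho> y * (norm (exchange w x y))\<^sup>2)"

lemma mass_nonneg: "0 \<le> mass"
  by (simp add: mass_def kernel_nonneg)

lemma average_measurable [measurable]:
  assumes [measurable]: "w \<in> borel_measurable borel"
  shows "average w \<in> borel_measurable borel"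
  unfolding average_def[abs_def] by measurable

text \<open>When \<open>\<integral> F(x, y) dx\<close> has the same value \<open>U\<close> for all \<open>y\<close>, integrating in \<open>x\<close> first
  leaves \<open>U\<close> times the mass of the kernel. The isometry property provides this hypothesis for
  the squared exchanges, and translation invariance provides it for \<open>(h (x + y))\<^sup>2\<close>.\<close>

lemma weighted_Tonelli:
  fixes F :: "'a \<Rightarrow> 'a \<Rightarrow> real"
  assumes [measurable]: "case_prod F \<in> borel_measurable (lborel \<Otimes>\<^sub>M lborel)"
    and nonneg: "\<And>x y. 0 \<le> F x y" and "0 \<le> U"
    and slice: "\<And>y. (\<integral>\<^sup>+x. ennreal (F x y) \<partial>lborel) = ennreal U"
  shows "AE x in lborel. integrable lborel (\<lambda>y. \<rho> y * F x y)"
    and "integrable lborel (\<lambda>x. LINT y|lborel. \<rho> y * F x y)"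
    and "(LINT x|lborel. LINT y|lborel. \<rho> y * F x y) = mass * U"
proof -
  have "(\<integral>\<^sup>+z. ennreal (case z of (x, y) \<Rightarrow> \<rho> y * F x y) \<partial>(lborel \<Otimes>\<^sub>M lborel))
      = (\<integral>\<^sup>+y. \<integral>\<^sup>+x. ennreal (\<rho> y * F x y) \<partial>lborel \<partial>lborel)"
    by (subst lborel_pair.nn_integral_snd[symmetric]) auto
  also have "\<dots> = (\<integral>\<^sup>+y. ennreal (\<rho> y) * ennreal U \<partial>lborel)"
    by (simp add: ennreal_mult kernel_nonneg nonneg nn_integral_cmult slice)
  also have "\<dots> = ennreal mass * ennreal U"
    unfolding mass_def
    by (subst nn_integral_multc)
      (simp_all add: nn_integral_eq_integral[OF kernel_integrable] kernel_nonneg)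
  also have "\<dots> = ennreal (mass * U)"
    by (simp add: ennreal_mult mass_nonneg \<open>0 \<le> U\<close>)
  finally have total: "(\<integral>\<^sup>+z. ennreal (case z of (x, y) \<Rightarrow> \<rho> y * F x y) \<partial>(lborel \<Otimes>\<^sub>M lborel))
      = ennreal (mass * U)" .
  have pair: "integrable (lborel \<Otimes>\<^sub>M lborel) (\<lambda>(x, y). \<rho> y * F x y)
      \<and> integral\<^sup>L (lborel \<Otimes>\<^sub>M lborel) (\<lambda>(x, y). \<rho> y * F x y) = mass * U"
    by (subst nn_integral_eq_integrable[symmetric])
      (use total in \<open>auto simp: kernel_nonneg nonneg mass_nonneg \<open>0 \<le> U\<close> split_beta\<close>)
  show "AE x in lborel. integrable lborel (\<lambda>y. \<rho> y * F x y)"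
    by (rule lborel_pair.AE_integrable_fst) (use pair in simp)
  show "integrable lborel (\<lambda>x. LINT y|lborel. \<rho> y * F x y)"
    by (rule lborel_pair.integrable_fst) (use pair in simp)
  show "(LINT x|lborel. LINT y|lborel. \<rho> y * F x y) = mass * U"
    by (subst lborel_pair.integral_fst) (use pair in simp_all)
qed

lemma exchange_energy:
  assumes "borel_L2 w"
  shows "AE x in lborel. integrable lborel (\<lambda>y. \<rho> y * (norm (exchange w x y))\<^sup>2)"
    and "integrable lborel (energy w)"
    and "(LINT x|lborel. energy w x) = mass * (LINT x|lborel. (norm (w x))\<^sup>2)"
proof -
  have [measurable]: "w \<in> borel_measurable borel"
    and int: "integrable lborel (\<lambda>x. (norm (w x))\<^sup>2)"
    using assms by (simp_all add: borel_L2_def)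
  have slice: "(\<integral>\<^sup>+x. ennreal ((norm (exchange w x y))\<^sup>2) \<partial>lborel)
      = ennreal (LINT x|lborel. (norm (w x))\<^sup>2)" for y
    by (simp add: nn_integral_exchange_sq nn_integral_eq_integral[OF int])
  have "(\<lambda>(x, y). (norm (exchange w x y))\<^sup>2) \<in> borel_measurable (lborel \<Otimes>\<^sub>M lborel)"
    by measurable
  note tonelli = weighted_Tonelli[OF this _ _ slice]
  show "AE x in lborel. integrable lborel (\<lambda>y. \<rho> y * (norm (exchange w x y))\<^sup>2)"
    by (rule tonelli(1)) simp_all
  show "integrable lborel (energy w)"
    unfolding energy_def[abs_def] by (rule tonelli(2)) simp_all
  show "(LINT x|lborel. energy w x) = mass * (LINT x|lborel. (norm (w x))\<^sup>2)"
    unfolding energy_def[abs_def] by (rule tonelli(3)) simp_all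
qed

lemma AE_integrable_translate:
  assumes "borel_L2 (h :: 'a \<Rightarrow> real)"
  shows "AE x in lborel. integrable lborel (\<lambda>y. \<rho> y * \<bar>h (x + y)\<bar>)"
proof -
  have [measurable]: "h \<in> borel_measurable borel"
    and int: "integrable lborel (\<lambda>x. (h x)\<^sup>2)"
    using assms by (simp_all add: borel_L2_def)
  have "AE x in lborel. integrable lborel (\<lambda>y. \<rho> y * (h (x + y))\<^sup>2)"
  proof (rule weighted_Tonelli(1))
    show "(\<integral>\<^sup>+x. ennreal ((h (x + y))\<^sup>2) \<partial>lborel) = ennreal (LINT x|lborel. (h x)\<^sup>2)" for y
      by (subst nn_integral_lborel_translate[of "\<lambda>x. ennreal ((h x)\<^sup>2)"])
        (simp_all add: nn_integral_eq_integral[OF int])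
  qed (simp_all, measurable)
  then show ?thesis
  proof eventually_elim
    case (elim x)
    have "integrable lborel (\<lambda>y. \<rho> y + \<rho> y * (h (x + y))\<^sup>2)"
      using elim kernel_integrable by simp
    then show ?case
    proof (rule Bochner_Integration.integrable_bound)
      have "\<bar>a\<bar> \<le> 1 + a\<^sup>2" for a :: real
        using le_one_plus_square[of "\<bar>a\<bar>"] by simp
      then show "AE y in lborel. norm (\<rho> y * \<bar>h (x + y)\<bar>) \<le> norm (\<rho> y + \<rho> y * (h (x + y))\<^sup>2)"
        using kernel_nonneg by (auto simp: abs_mult intro!: always_eventually)
          (metis mult_left_mono distrib_left mult.right_neutral)
    qed measurable
  qed
qed

text \<open>The second inequality is the nonnegativity of the \<open>\<rho>\<close>-weighted integral of
  \<open>|m g(y) - J|\<^sup>2\<close>, where \<open>J\<close> is the weighted integral of \<open>g\<close> and \<open>m\<close> the mass; this choice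
  avoids dividing by \<open>m\<close>.\<close>

lemma weighted_Cauchy_Schwarz:
  fixes g :: "'a \<Rightarrow> 'b::euclidean_space"
  assumes [measurable]: "g \<in> borel_measurable borel"
    and R: "integrable lborel (\<lambda>y. \<rho> y * (norm (g y))\<^sup>2)"
  shows "integrable lborel (\<lambda>y. \<rho> y *\<^sub>R g y)"
    and "(norm (LINT y|lborel. \<rho> y *\<^sub>R g y))\<^sup>2 \<le> mass * (LINT y|lborel. \<rho> y * (norm (g y))\<^sup>2)"
proof -
  have "integrable lborel (\<lambda>y. \<rho> y + \<rho> y * (norm (g y))\<^sup>2)"
    using R kernel_integrable by simp
  then show int: "integrable lborel (\<lambda>y. \<rho> y *\<^sub>R g y)"
  proof (rule Bochner_Integration.integrable_bound)
    show "AE y in lborel. norm (\<rho> y *\<^sub>R g y) \<le> norm (\<rho> y + \<rho> y * (norm (g y))\<^sup>2)"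
      using kernel_nonneg le_one_plus_square by (auto intro!: always_eventually)
        (metis mult_left_mono distrib_left mult.right_neutral)
  qed measurable
  define J where "J = (LINT y|lborel. \<rho> y *\<^sub>R g y)"
  let ?R = "LINT y|lborel. \<rho> y * (norm (g y))\<^sup>2"
  have inner: "integrable lborel (\<lambda>y. \<rho> y * (J \<bullet> g y))"
    "(LINT y|lborel. \<rho> y * (J \<bullet> g y)) = J \<bullet> J"
    using integrable_inner_right[of J lborel "\<lambda>y. \<rho> y *\<^sub>R g y"]
      integral_inner_right[of J lborel "\<lambda>y. \<rho> y *\<^sub>R g y"] int
    by (simp_all add: J_def)
  have expand: "(norm (mass *\<^sub>R g y - J))\<^sup>2
      = mass\<^sup>2 * (norm (g y))\<^sup>2 - 2 * mass * (J \<bullet> g y) + J \<bullet> J" for y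
    unfolding power2_norm_eq_inner
    by (simp add: inner_diff_left inner_diff_right inner_commute power2_eq_square algebra_simps)
  have "0 \<le> (LINT y|lborel. \<rho> y * (norm (mass *\<^sub>R g y - J))\<^sup>2)"
    by (simp add: kernel_nonneg)
  also have "\<dots> = (LINT y|lborel. mass\<^sup>2 * (\<rho> y * (norm (g y))\<^sup>2)
      - 2 * mass * (\<rho> y * (J \<bullet> g y)) + (J \<bullet> J) * \<rho> y)"
    by (rule Bochner_Integration.integral_cong)
      (auto simp: expand algebra_simps)
  also have "\<dots> = mass\<^sup>2 * ?R - 2 * mass * (J \<bullet> J) + (J \<bullet> J) * mass"
    using R inner kernel_integrable by (simp add: mass_def)
  also have "\<dots> = mass * (mass * ?R - J \<bullet> J)"
    by (simp add: power2_eq_square algebra_simps)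
  finally have *: "0 \<le> mass * (mass * ?R - J \<bullet> J)" .
  show "(norm (LINT y|lborel. \<rho> y *\<^sub>R g y))\<^sup>2 \<le> mass * ?R"
  proof (cases "mass = 0")
    case True
    then have "AE y in lborel. \<rho> y = 0"
      using integral_nonneg_eq_0_iff_AE[OF kernel_integrable] kernel_nonneg by (simp add: mass_def)
    then have "(LINT y|lborel. \<rho> y *\<^sub>R g y) = 0"
      by (intro integral_eq_zero_AE) auto
    then show ?thesis using True by simp
  next
    case False
    then show ?thesis
      using * mass_nonneg by (simp add: zero_le_mult_iff power2_norm_eq_inner flip: J_def)
  qed
qed

lemma average_bounds:
  assumes "borel_L2 w"
  shows "AE x in lborel. integrable lborel (\<lambda>y. \<rho> y *\<^sub>R exchange w x y)
           \<and> (norm (average w x))\<^sup>2 \<le> mass * energy w x"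
  using exchange_energy(1)[OF assms]
proof eventually_elim
  case (elim x)
  have [measurable]: "w \<in> borel_measurable borel"
    using assms by (simp add: borel_L2_def)
  show ?case
    unfolding average_def energy_def
    by (intro conjI weighted_Cauchy_Schwarz elim) measurable
qed

text \<open>The averaging operator has \<open>L\<^sup>2\<close> norm at most the mass of the kernel: Cauchy--Schwarz pointwise,
  then the isometry property of each exchange.\<close>

lemma average_contraction:
  assumes "borel_L2 w"
  shows "borel_L2 (average w)"
    and "(LINT x|lborel. (norm (average w x))\<^sup>2) \<le> mass\<^sup>2 * (LINT x|lborel. (norm (w x))\<^sup>2)"
proof -
  have [measurable]: "w \<in> borel_measurable borel"
    using assms by (simp add: borel_L2_def)
  have dom: "integrable lborel (\<lambda>x. mass * energy w x)"
    using exchange_energy(2)[OF assms] by simp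
  have le: "AE x in lborel. (norm (average w x))\<^sup>2 \<le> mass * energy w x"
    using average_bounds[OF assms] by eventually_elim simp
  have int: "integrable lborel (\<lambda>x. (norm (average w x))\<^sup>2)"
    by (rule Bochner_Integration.integrable_bound[OF dom]) (use le in \<open>auto elim!: eventually_mono\<close>)
  then show "borel_L2 (average w)"
    by (simp add: borel_L2_def)
  have "(LINT x|lborel. (norm (average w x))\<^sup>2) \<le> (LINT x|lborel. mass * energy w x)"
    by (rule integral_mono_AE[OF int dom le])
  then show "(LINT x|lborel. (norm (average w x))\<^sup>2) \<le> mass\<^sup>2 * (LINT x|lborel. (norm (w x))\<^sup>2)"
    by (simp add: exchange_energy(3)[OF assms] power2_eq_square mult.assoc)
qed

text \<open>The triangle inequality would give \<open>(\<lambda> + m) \<parallel>v\<parallel> \<le> m \<parallel>v\<parallel> + \<parallel>f\<parallel>\<close>. The proof obtains the same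
  bound pointwise before integrating, with Young's inequality in place of Minkowski's: the weights
  \<open>m : \<lambda>\<close> are those for which the terms in \<open>v\<close> leave exactly \<open>\<lambda>\<^sup>2 \<parallel>v\<parallel>\<^sup>2\<close>.\<close>

lemma a_priori_estimate:
  assumes v: "borel_L2 v" and f: "borel_L2 f" and "0 < lam"
    and eq: "AE x in lborel. (lam + mass) *\<^sub>R v x = average v x + f x"
  shows "lam\<^sup>2 * (LINT x|lborel. (norm (v x))\<^sup>2) \<le> (LINT x|lborel. (norm (f x))\<^sup>2)"
proof -
  let ?V = "LINT x|lborel. (norm (v x))\<^sup>2" and ?F = "LINT x|lborel. (norm (f x))\<^sup>2"
  \<comment> \<open>The bound \<open>(\<alpha> + \<beta>)\<^sup>2 \<le> (m + \<lambda>) (\<alpha>\<^sup>2 / m + \<beta>\<^sup>2 / \<lambda>)\<close>, multiplied by \<open>\<lambda>\<close> and with \<open>R\<close> in place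
    of \<open>\<alpha>\<^sup>2 / m\<close>, so that it also covers a kernel of mass \<open>m = 0\<close>.\<close>
  have young: "lam * (norm (a + b))\<^sup>2 \<le> (lam + mass) * (lam * R + (norm b)\<^sup>2)"
    if "(norm a)\<^sup>2 \<le> mass * R" "0 \<le> R" for a b :: 'a and R
  proof -
    let ?s = "lam\<^sup>2 * R" and ?t = "mass * (norm b)\<^sup>2"
    have "(2 * lam * norm a * norm b)\<^sup>2 = 4 * lam\<^sup>2 * (norm b)\<^sup>2 * (norm a)\<^sup>2"
      by (simp add: power_mult_distrib)
    also have "\<dots> \<le> 4 * lam\<^sup>2 * (norm b)\<^sup>2 * (mass * R)"
      by (intro mult_left_mono that) simp
    also have "\<dots> = (?s + ?t)\<^sup>2 - (?s - ?t)\<^sup>2"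
      by (simp add: power2_eq_square algebra_simps)
    also have "\<dots> \<le> (?s + ?t)\<^sup>2"
      by simp
    finally have "2 * lam * norm a * norm b \<le> ?s + ?t"
      by (rule power2_le_imp_le) (simp add: that mass_nonneg)
    moreover have "lam * (norm a)\<^sup>2 \<le> lam * (mass * R)"
      using that \<open>0 < lam\<close> by simp
    moreover have "lam * (norm (a + b))\<^sup>2 \<le> lam * (norm a + norm b)\<^sup>2"
      using \<open>0 < lam\<close> by (simp add: power_mono norm_triangle_ineq)
    ultimately show ?thesis
      by (simp add: power2_eq_square algebra_simps)
  qed
  have "lam * (lam + mass)\<^sup>2 * ?V = (LINT x|lborel. lam * (lam + mass)\<^sup>2 * (norm (v x))\<^sup>2)"
    by simp
  also have "\<dots> \<le> (LINT x|lborel. (lam + mass) * (lam * energy v x + (norm (f x))\<^sup>2))"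
  proof (rule integral_mono_AE)
    show "AE x in lborel. lam * (lam + mass)\<^sup>2 * (norm (v x))\<^sup>2
        \<le> (lam + mass) * (lam * energy v x + (norm (f x))\<^sup>2)"
      using eq average_bounds[OF v]
    proof eventually_elim
      case (elim x)
      have "(norm (average v x + f x))\<^sup>2 = (lam + mass)\<^sup>2 * (norm (v x))\<^sup>2"
        by (simp add: elim(1)[symmetric] power_mult_distrib)
      moreover have "0 \<le> energy v x"
        by (simp add: energy_def kernel_nonneg)
      ultimately show ?case
        using young[of "average v x" "energy v x" "f x"] elim by (simp add: mult.assoc)
    qed
  qed (use v f exchange_energy(2)[OF v] in \<open>simp_all add: borel_L2_def\<close>)
  also have "\<dots> = (lam + mass) * (lam * (mass * ?V) + ?F)"
    using f exchange_energy(2,3)[OF v] by (simp add: borel_L2_def)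
  finally have "(lam + mass) * (lam\<^sup>2 * ?V) \<le> (lam + mass) * ?F"
    by (simp add: power2_eq_square algebra_simps)
  then show ?thesis
    using \<open>0 < lam\<close> mass_nonneg by (simp add: mult_le_cancel_left)
qed


lemma average_diff:
  assumes "borel_L2 v" "borel_L2 w"
  shows "AE x in lborel. average (\<lambda>x. v x - w x) x = average v x - average w x"
  using average_bounds[OF assms(1)] average_bounds[OF assms(2)]
  by eventually_elim (simp add: average_def exchange_diff scaleR_diff_right)

lemma resolvent_unique:
  assumes v: "borel_L2 v" and w: "borel_L2 w" and "0 < lam"
    and eqv: "AE x in lborel. (lam + mass) *\<^sub>R v x = average v x + f x"
    and eqw: "AE x in lborel. (lam + mass) *\<^sub>R w x = average w x + f x"
  shows "AE x in lborel. v x = w x"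
proof -
  let ?d = "\<lambda>x. v x - w x"
  have d: "borel_L2 ?d"
    by (rule borel_L2_diff[OF v w])
  have "AE x in lborel. (lam + mass) *\<^sub>R ?d x = average ?d x + 0"
    using eqv eqw average_diff[OF v w] by eventually_elim (simp add: scaleR_diff_right)
  from a_priori_estimate[OF d _ \<open>0 < lam\<close> this]
  have "lam\<^sup>2 * (LINT x|lborel. (norm (?d x))\<^sup>2) \<le> 0"
    by (simp add: borel_L2_def)
  then have "(LINT x|lborel. (norm (?d x))\<^sup>2) = 0"
    using \<open>0 < lam\<close> by (simp add: mult_le_0_iff order_antisym)
  then have "AE x in lborel. (norm (?d x))\<^sup>2 = 0"
    using d by (subst (asm) integral_nonneg_eq_0_iff_AE) (simp_all add: borel_L2_def)
  then show ?thesis by simp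
qed

end

section \<open>Solving by a Neumann series\<close>

text \<open>This replaces completeness of \<open>L\<^sup>2\<close>. If the squared norms decay like \<open>r\<^sup>k\<close> and \<open>r < s < 1\<close>, then
  \<open>H = \<Sum>k. |d\<^sub>k|\<^sup>2 / s\<^sup>k\<close> still has finite integral, and each term of the sum is at most \<open>H\<close>. So
  \<open>|d\<^sub>k| \<le> (\<surd>s)\<^sup>k \<surd>H\<close>: one square integrable function dominates all the \<open>d\<^sub>k\<close>
  geometrically, at almost every point.\<close>

lemma geometric_L2_imp_AE_dominated:
  fixes d :: "nat \<Rightarrow> 'a::euclidean_space \<Rightarrow> 'b::euclidean_space"
  assumes d: "\<And>k. borel_L2 (d k)" and r: "0 \<le> r" "r < 1" and "0 \<le> c"
    and le: "\<And>k. (LINT x|lborel. (norm (d k x))\<^sup>2) \<le> c * r ^ k"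
  obtains \<sigma> :: real and h :: "'a \<Rightarrow> real" where "0 \<le> \<sigma>" "\<sigma> < 1" "borel_L2 h"
    "AE x in lborel. 0 \<le> h x \<and> (\<forall>k. norm (d k x) \<le> \<sigma> ^ k * h x)"
proof -
  have [measurable]: "d k \<in> borel_measurable borel" for k
    using d by (simp add: borel_L2_def)
  obtain s where s: "r < s" "s < 1"
    using dense r by blast
  with r have "0 < s" by simp
  define H where "H x = (\<Sum>k. ennreal ((norm (d k x))\<^sup>2 / s ^ k))" for x
  have [measurable]: "H \<in> borel_measurable borel"
    unfolding H_def[abs_def] by measurable
  have "(\<integral>\<^sup>+x. H x \<partial>lborel) = (\<Sum>k. \<integral>\<^sup>+x. ennreal ((norm (d k x))\<^sup>2 / s ^ k) \<partial>lborel)"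
    unfolding H_def by (rule nn_integral_suminf) measurable
  also have "\<dots> = (\<Sum>k. ennreal ((LINT x|lborel. (norm (d k x))\<^sup>2) / s ^ k))"
  proof (intro arg_cong[where f=suminf] ext)
    show "(\<integral>\<^sup>+x. ennreal ((norm (d k x))\<^sup>2 / s ^ k) \<partial>lborel)
        = ennreal ((LINT x|lborel. (norm (d k x))\<^sup>2) / s ^ k)" for k
      by (subst nn_integral_eq_integral) (use d \<open>0 < s\<close> in \<open>auto simp: borel_L2_def\<close>)
  qed
  also have "\<dots> \<le> (\<Sum>k. ennreal (c * (r / s) ^ k))"
  proof (intro suminf_le ennreal_leI)
    show "(LINT x|lborel. (norm (d k x))\<^sup>2) / s ^ k \<le> c * (r / s) ^ k" for k
      using le[of k] \<open>0 < s\<close> by (simp add: power_divide divide_right_mono)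
  qed simp_all
  also have "\<dots> < \<infinity>"
  proof -
    have "summable (\<lambda>k. c * (r / s) ^ k)"
      using s r by (intro summable_mult summable_geometric) simp
    then show ?thesis
      using r \<open>0 < s\<close> \<open>0 \<le> c\<close> by (simp add: ennreal_suminf_neq_top less_top)
  qed
  finally have fin: "(\<integral>\<^sup>+x. H x \<partial>lborel) < \<infinity>" .
  define h where "h x = sqrt (enn2real (H x))" for x
  have "borel_L2 h"
    unfolding borel_L2_def
  proof
    show [measurable]: "h \<in> borel_measurable borel"
      unfolding h_def[abs_def] by measurable
    have "(\<integral>\<^sup>+x. ennreal ((norm (h x))\<^sup>2) \<partial>lborel) \<le> (\<integral>\<^sup>+x. H x \<partial>lborel)"
    proof (rule nn_integral_mono)
      show "ennreal ((norm (h x))\<^sup>2) \<le> H x" for x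
        by (cases "H x") (simp_all add: h_def)
    qed
    then show "integrable lborel (\<lambda>x. (norm (h x))\<^sup>2)"
      using fin by (intro integrableI_nonneg) (auto intro: le_less_trans)
  qed
  moreover have "AE x in lborel. 0 \<le> h x \<and> (\<forall>k. norm (d k x) \<le> sqrt s ^ k * h x)"
  proof -
    have "AE x in lborel. H x \<noteq> \<infinity>"
      by (rule nn_integral_PInf_AE) (use fin in auto)
    then show ?thesis
    proof eventually_elim
      case (elim x)
      have "norm (d k x) \<le> sqrt s ^ k * h x" for k
      proof -
        have "ennreal ((norm (d k x))\<^sup>2 / s ^ k) \<le> H x"
          unfolding H_def using sum_le_suminf[of "\<lambda>k. ennreal ((norm (d k x))\<^sup>2 / s ^ k)" "{k}"] by simp
        also have "H x = ennreal (enn2real (H x))"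
          using elim by (simp add: less_top)
        finally have "(norm (d k x))\<^sup>2 / s ^ k \<le> enn2real (H x)"
          by simp
        then have "(norm (d k x))\<^sup>2 \<le> (sqrt s ^ k * h x)\<^sup>2"
          using \<open>0 < s\<close>
          by (simp add: h_def power_mult_distrib divide_le_eq mult.commute flip: real_sqrt_power)
        then show ?thesis
          by (rule power2_le_imp_le) (use \<open>0 < s\<close> in \<open>simp add: h_def\<close>)
      qed
      then show ?case by (simp add: h_def)
    qed
  qed
  moreover have "0 \<le> sqrt s" "sqrt s < 1"
    using \<open>0 < s\<close> s by simp_all
  ultimately show ?thesis
    using that by blast
qed

lemma exchange_sums:
  assumes "(\<lambda>k. d k x) sums u x" "(\<lambda>k. d k (x + y)) sums u (x + y)"
  shows "(\<lambda>k. exchange (d k) x y) sums exchange u x y"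
  unfolding exchange_def
  by (intro sums_add sums_diff bounded_linear.sums[OF bounded_linear_line_proj] assms)

context nonneg_kernel
begin

text \<open>Dominated convergence: at almost every \<open>x\<close> the integrands of the \<open>average (d k) x\<close> are bounded
  by \<open>\<sigma>\<^sup>k\<close> times the function \<open>\<rho> y * (2 * h x + \<bar>h (x + y)\<bar>)\<close>, which is integrable in \<open>y\<close>.\<close>

lemma average_sums:
  fixes d :: "nat \<Rightarrow> 'a \<Rightarrow> 'a"
  assumes [measurable]: "\<And>k. d k \<in> borel_measurable borel" "u \<in> borel_measurable borel"
    and "0 \<le> \<sigma>" "\<sigma> < 1" and h: "borel_L2 h"
    and dom: "AE x in lborel. 0 \<le> h x \<and> (\<forall>k. norm (d k x) \<le> \<sigma> ^ k * h x)"
    and sums: "AE x in lborel. (\<lambda>k. d k x) sums u x"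
  shows "AE x in lborel. (\<lambda>k. average (d k) x) sums average u x"
  using dom sums AE_integrable_translate[OF h]
proof eventually_elim
  case (elim x)
  have [measurable]: "h \<in> borel_measurable borel"
    using h by (simp add: borel_L2_def)
  define B where "B y = \<rho> y * (2 * h x) + \<rho> y * \<bar>h (x + y)\<bar>" for y
  have B: "integrable lborel B"
    unfolding B_def[abs_def] using elim kernel_integrable by simp
  have le: "AE y in lborel. \<forall>k. norm (\<rho> y *\<^sub>R exchange (d k) x y) \<le> \<sigma> ^ k * B y"
    using AE_lborel_translate[OF dom, of x]
  proof eventually_elim
    case y: (elim y)
    show ?case
    proof
      fix k
      have "norm (exchange (d k) x y) \<le> 2 * norm (d k x) + norm (d k (x + y))"
        by (rule norm_exchange_le)
      also have "\<dots> \<le> 2 * (\<sigma> ^ k * h x) + \<sigma> ^ k * \<bar>h (x + y)\<bar>"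
        using elim y by (intro add_mono mult_left_mono) auto
      finally have "\<rho> y * norm (exchange (d k) x y)
          \<le> \<rho> y * (2 * (\<sigma> ^ k * h x) + \<sigma> ^ k * \<bar>h (x + y)\<bar>)"
        using kernel_nonneg by (rule mult_left_mono)
      then show "norm (\<rho> y *\<^sub>R exchange (d k) x y) \<le> \<sigma> ^ k * B y"
        by (simp add: B_def kernel_nonneg algebra_simps)
    qed
  qed
  have int: "integrable lborel (\<lambda>y. \<rho> y *\<^sub>R exchange (d k) x y)" for k
  proof (rule Bochner_Integration.integrable_bound)
    show "integrable lborel (\<lambda>y. \<sigma> ^ k * B y)"
      using B by simp
    show "AE y in lborel. norm (\<rho> y *\<^sub>R exchange (d k) x y) \<le> norm (\<sigma> ^ k * B y)"
      using le by eventually_elim (auto intro: order_trans[OF _ abs_ge_self])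
  qed measurable
  have geom: "summable (\<lambda>k. \<sigma> ^ k * b)" for b :: real
    using \<open>0 \<le> \<sigma>\<close> \<open>\<sigma> < 1\<close> by (intro summable_mult2 summable_geometric) simp
  have "(\<lambda>k. average (d k) x) sums (LINT y|lborel. (\<Sum>k. \<rho> y *\<^sub>R exchange (d k) x y))"
    unfolding average_def
  proof (rule sums_integral[OF int])
    show "AE y in lborel. summable (\<lambda>k. norm (\<rho> y *\<^sub>R exchange (d k) x y))"
      using le by eventually_elim (rule summable_comparison_test'[OF geom], auto)
    show "summable (\<lambda>k. LINT y|lborel. norm (\<rho> y *\<^sub>R exchange (d k) x y))"
    proof (rule summable_comparison_test'[OF geom])
      show "norm (LINT y|lborel. norm (\<rho> y *\<^sub>R exchange (d k) x y)) \<le> \<sigma> ^ k * (LINT y|lborel. B y)"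
        for k
      proof -
        have "(LINT y|lborel. norm (\<rho> y *\<^sub>R exchange (d k) x y)) \<le> (LINT y|lborel. \<sigma> ^ k * B y)"
        proof (rule integral_mono_AE)
          show "AE y in lborel. norm (\<rho> y *\<^sub>R exchange (d k) x y) \<le> \<sigma> ^ k * B y"
            using le by eventually_elim blast
        qed (use int B in \<open>simp_all only: integrable_norm integrable_mult_right\<close>)
        then show ?thesis by simp
      qed
    qed
  qed
  also have "(LINT y|lborel. (\<Sum>k. \<rho> y *\<^sub>R exchange (d k) x y)) = average u x"
    unfolding average_def
  proof (rule integral_cong_AE)
    show "AE y in lborel. (\<Sum>k. \<rho> y *\<^sub>R exchange (d k) x y) = \<rho> y *\<^sub>R exchange u x y"
      using AE_lborel_translate[OF sums, of x]
      by eventually_elim (intro sums_unique[symmetric] sums_scaleR_right exchange_sums elim)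
  qed measurable
  finally show ?case .
qed

text \<open>The terms \<open>d\<^sub>k = (t J)\<^sup>k (t f)\<close>, with \<open>J\<close> the averaging operator and \<open>t = 1 / (\<lambda> + m)\<close>,
  decay in \<open>L\<^sup>2\<close> like \<open>q\<^sup>k\<close> for \<open>q = m / (\<lambda> + m)\<close>. Their sum \<open>u\<close> satisfies \<open>u = t f + t J u\<close>.\<close>

lemma resolvent_exists:
  assumes f: "borel_L2 f" and "0 < lam"
  obtains u where "borel_L2 u" "AE x in lborel. (lam + mass) *\<^sub>R u x = average u x + f x"
proof -
  define t where "t = 1 / (lam + mass)"
  have t: "0 < t" "(lam + mass) * t = 1"
    using \<open>0 < lam\<close> mass_nonneg by (simp_all add: t_def)
  define q where "q = t * mass"
  have q: "0 \<le> q" "q < 1"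
    using \<open>0 < lam\<close> mass_nonneg by (simp_all add: q_def t_def)
  define d where "d k = ((\<lambda>w x. t *\<^sub>R average w x) ^^ k) (\<lambda>x. t *\<^sub>R f x)" for k
  have d_0: "d 0 = (\<lambda>x. t *\<^sub>R f x)" and d_Suc: "d (Suc k) = (\<lambda>x. t *\<^sub>R average (d k) x)" for k
    by (simp_all add: d_def)
  define c where "c = (LINT x|lborel. (norm (d 0 x))\<^sup>2)"
  have scale: "borel_L2 (\<lambda>x. t *\<^sub>R w x)" if "borel_L2 w" for w :: "'a \<Rightarrow> 'a"
    using that by (auto simp: borel_L2_def power_mult_distrib intro: borel_measurable_scaleR)
  have d: "borel_L2 (d k) \<and> (LINT x|lborel. (norm (d k x))\<^sup>2) \<le> c * (q\<^sup>2) ^ k" for k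
  proof (induction k)
    case 0
    show ?case using scale[OF f] by (simp add: c_def d_0)
  next
    case (Suc k)
    have "(LINT x|lborel. (norm (d (Suc k) x))\<^sup>2) = t\<^sup>2 * (LINT x|lborel. (norm (average (d k) x))\<^sup>2)"
      by (simp add: d_Suc power_mult_distrib)
    also have "\<dots> \<le> t\<^sup>2 * (mass\<^sup>2 * (LINT x|lborel. (norm (d k x))\<^sup>2))"
      using average_contraction(2)[of "d k"] Suc by (intro mult_left_mono) auto
    also have "\<dots> \<le> t\<^sup>2 * (mass\<^sup>2 * (c * (q\<^sup>2) ^ k))"
      using Suc by (intro mult_left_mono) auto
    also have "\<dots> = c * (q\<^sup>2) ^ Suc k"
      by (simp add: q_def power_mult_distrib)
    finally show ?case
      using scale average_contraction(1) Suc by (simp add: d_Suc)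
  qed
  have q2: "0 \<le> q\<^sup>2" "q\<^sup>2 < 1"
    using q by (simp_all add: power_less_one_iff abs_square_less_1)
  have "0 \<le> c" by (simp add: c_def)
  from geometric_L2_imp_AE_dominated[OF _ q2 \<open>0 \<le> c\<close>, of d] d
  obtain \<sigma> h where \<sigma>: "0 \<le> \<sigma>" "\<sigma> < 1" and h: "borel_L2 (h :: 'a \<Rightarrow> real)"
    and dom: "AE x in lborel. 0 \<le> h x \<and> (\<forall>k. norm (d k x) \<le> \<sigma> ^ k * h x)"
    by blast
  have [measurable]: "d k \<in> borel_measurable borel" for k
    using d by (simp add: borel_L2_def)
  define u where "u x = (\<Sum>k. d k x)" for x
  have [measurable]: "u \<in> borel_measurable borel"
    unfolding u_def[abs_def] by measurable
  have geom: "(\<lambda>k. \<sigma> ^ k * b) sums (1 / (1 - \<sigma>) * b)" for b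
    using \<sigma> by (intro sums_mult2 geometric_sums) simp
  have sums: "AE x in lborel. (\<lambda>k. d k x) sums u x \<and> norm (u x) \<le> 1 / (1 - \<sigma>) * norm (h x)"
    using dom
  proof eventually_elim
    case (elim x)
    have s: "summable (\<lambda>k. norm (d k x))"
      by (rule summable_comparison_test'[OF sums_summable[OF geom[of "h x"]]]) (use elim in simp)
    then have "norm (u x) \<le> (\<Sum>k. norm (d k x))"
      unfolding u_def by (rule summable_norm)
    also have "\<dots> \<le> (\<Sum>k. \<sigma> ^ k * h x)"
      using elim s sums_summable[OF geom] by (intro suminf_le) auto
    also have "\<dots> = 1 / (1 - \<sigma>) * h x"
      by (rule sums_unique[OF geom, symmetric])
    finally show ?case
      using s elim by (simp add: u_def summable_norm_cancel summable_sums)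
  qed
  then have "borel_L2 u"
    by (intro borel_L2_dominated[OF _ h, where c = "1 / (1 - \<sigma>)"]) (auto elim: eventually_mono)
  moreover have "AE x in lborel. (\<lambda>k. average (d k) x) sums average u x"
    using sums by (intro average_sums[OF _ _ \<sigma> h dom]) (auto elim: eventually_mono)
  then have "AE x in lborel. (lam + mass) *\<^sub>R u x = average u x + f x"
    using sums
  proof eventually_elim
    case (elim x)
    have "(\<lambda>k. d (Suc k) x) sums (t *\<^sub>R average u x)"
      unfolding d_Suc using elim by (intro sums_scaleR_right) simp
    then have "(\<lambda>k. d k x) sums (t *\<^sub>R average u x + d 0 x)"
      by (rule sums_Suc)
    then have "u x = t *\<^sub>R average u x + t *\<^sub>R f x"
      using elim sums_unique2 by (auto simp: d_0)
    then show ?case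
      using t by (simp add: scaleR_add_right)
  qed
  ultimately show ?thesis by (rule that)
qed

end

section \<open>From Lebesgue measurable to Borel measurable representatives\<close>

lemma lebesgue_measurable_ex_borel:
  fixes g :: "'a::euclidean_space \<Rightarrow> 'b::euclidean_space"
  assumes g: "g \<in> borel_measurable lebesgue"
  obtains g' where "g' \<in> borel_measurable borel" "AE x in lborel. g x = g' x"
proof -
  have "\<forall>b. \<exists>c. c \<in> borel_measurable borel \<and> (AE x in lborel. g x \<bullet> b = c x)"
  proof
    fix b
    have "(\<lambda>x. g x \<bullet> b) \<in> borel_measurable lebesgue"
      using g by measurable
    from completion_ex_borel_measurable_real[OF this]
    show "\<exists>c. c \<in> borel_measurable borel \<and> (AE x in lborel. g x \<bullet> b = c x)"
      by auto
  qed
  from choice[OF this] obtain c where c [measurable]: "\<And>b. c b \<in> borel_measurable borel"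
    and ae: "\<And>b. AE x in lborel. g x \<bullet> b = c b x"
    by blast
  have "AE x in lborel. \<forall>b\<in>Basis. g x \<bullet> b = c b x"
    by (rule AE_finite_allI) (use ae in auto)
  then have "AE x in lborel. g x = (\<Sum>b\<in>Basis. c b x *\<^sub>R b)"
    by eventually_elim (metis (no_types, lifting) euclidean_representation sum.cong)
  then show ?thesis
    by (rule that[rotated]) measurable
qed

lemma square_integrable_ex_borel:
  assumes "square_integrable u"
  obtains u' where "borel_L2 u'" "AE x in lborel. u x = u' x"
proof -
  obtain u' where [measurable]: "u' \<in> borel_measurable borel" and ae: "AE x in lborel. u x = u' x"
    using assms lebesgue_measurable_ex_borel unfolding square_integrable_def by blast
  have "integrable lebesgue (\<lambda>x. (norm (u' x))\<^sup>2)"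
  proof (rule integrable_cong_AE_imp)
    show "integrable lebesgue (\<lambda>x. (norm (u x))\<^sup>2)"
      using assms by (simp add: square_integrable_def)
    show "(\<lambda>x. (norm (u' x))\<^sup>2) \<in> borel_measurable lebesgue"
      by (rule measurable_completion) measurable
    show "AE x in lebesgue. (norm (u x))\<^sup>2 = (norm (u' x))\<^sup>2"
      unfolding AE_completion_iff using ae by eventually_elim simp
  qed
  then have "borel_L2 u'"
    by (subst (asm) integrable_completion) (simp_all add: borel_L2_def)
  then show ?thesis using ae by (rule that)
qed

lemma borel_L2_imp_square_integrable:
  assumes "borel_L2 u"
  shows "square_integrable u"
proof -
  have [measurable]: "u \<in> borel_measurable borel" and int: "integrable lborel (\<lambda>x. (norm (u x))\<^sup>2)"
    using assms by (simp_all add: borel_L2_def)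
  have "u \<in> borel_measurable lebesgue"
    by (rule measurable_completion) measurable
  moreover have "integrable lebesgue (\<lambda>x. (norm (u x))\<^sup>2)"
    by (subst integrable_completion) (use int in measurable)
  ultimately show ?thesis by (simp add: square_integrable_def)
qed

lemma L2_norm_eq_borel:
  assumes u: "u \<in> borel_measurable lebesgue" and u': "borel_L2 u'"
    and ae: "AE x in lborel. u x = u' x"
  shows "L2_norm u = sqrt (LINT x|lborel. (norm (u' x))\<^sup>2)"
proof -
  have [measurable]: "u' \<in> borel_measurable borel"
    using u' by (simp add: borel_L2_def)
  have "(LINT x|lebesgue. (norm (u x))\<^sup>2) = (LINT x|lebesgue. (norm (u' x))\<^sup>2)"
  proof (rule integral_cong_AE)
    show "(\<lambda>x. (norm (u x))\<^sup>2) \<in> borel_measurable lebesgue"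
      using u by measurable
    show "(\<lambda>x. (norm (u' x))\<^sup>2) \<in> borel_measurable lebesgue"
      by (rule measurable_completion) measurable
    show "AE x in lebesgue. (norm (u x))\<^sup>2 = (norm (u' x))\<^sup>2"
      unfolding AE_completion_iff using ae by eventually_elim simp
  qed
  also have "\<dots> = (LINT x|lborel. (norm (u' x))\<^sup>2)"
    by (rule integral_completion) measurable
  finally show ?thesis by (simp add: L2_norm_def)
qed

lemma op_integrand_eq_line_proj:
  "op_integrand \<rho> u x y = \<rho> y *\<^sub>R line_proj y (u (x + y) - u x)"
proof -
  have "(((1 / (norm y)\<^sup>2) *\<^sub>R outer y) *v v) = line_proj y v" for v
    by (simp add: vec_eq_iff matrix_vector_mult_def outer_def line_proj_def inner_vec_def
        sum_distrib_left sum_distrib_right sum_divide_distrib algebra_simps)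
  then show ?thesis by (simp add: op_integrand_def)
qed

text \<open>Changing \<open>\<rho>\<close>, \<open>u\<close> and \<open>f\<close> on null sets changes the integrand in \<open>y\<close> only on a null set, for almost
  every \<open>x\<close>, because a translate of a null set is null. Absolute convergence at almost every
  \<open>x\<close> follows from the square integrability of \<open>u\<close>, so that only the equation is left on the
  right-hand side.\<close>

lemma strong_solution_iff_average:
  fixes \<rho> :: "real^'n \<Rightarrow> real"
  assumes "nonneg_kernel \<rho>'" and \<rho>: "AE y in lborel. \<rho> y = \<rho>' y"
    and u': "borel_L2 u'" and u: "AE x in lborel. u x = u' x" and f: "AE x in lborel. f x = f' x"
  shows "strong_solution \<rho> lam f u \<longleftrightarrow>
    (AE x in lborel. (lam + nonneg_kernel.mass \<rho>') *\<^sub>R u' x = nonneg_kernel.average \<rho>' u' x + f' x)"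
proof -
  interpret nonneg_kernel \<rho>' by fact
  have [measurable]: "u' \<in> borel_measurable borel"
    using u' by (simp add: borel_L2_def)
  have "AE x in lborel. (integrable lebesgue (op_integrand \<rho> u x) \<and> op_L \<rho> u x + lam *\<^sub>R u x = f x)
      \<longleftrightarrow> (lam + mass) *\<^sub>R u' x = average u' x + f' x"
    using u f average_bounds[OF u']
  proof eventually_elim
    case (elim x)
    \<comment> \<open>The integrand of the operator splits into the exchange and the term \<open>\<rho> y u(x)\<close>, whose integral
      is the summand \<open>m u(x)\<close> that moves to the other side of the equation.\<close>
    define G where "G y = \<rho>' y *\<^sub>R exchange u' x y - \<rho>' y *\<^sub>R u' x" for y
    have G: "integrable lborel G" "(LINT y|lborel. G y) = average u' x - mass *\<^sub>R u' x"
      unfolding G_def[abs_def] using elim kernel_integrable by (simp_all add: average_def mass_def)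
    then have [measurable]: "G \<in> borel_measurable borel"
      by (auto dest: borel_measurable_integrable)
    have "AE y in lborel. op_integrand \<rho> u x y = G y"
      using \<rho> AE_lborel_translate[OF u, of x]
      by eventually_elim
        (simp add: op_integrand_eq_line_proj G_def exchange_def elim(1) scaleR_add_right)
    then have ae: "AE y in lebesgue. G y = op_integrand \<rho> u x y"
      unfolding AE_completion_iff by eventually_elim simp
    have G_leb: "G \<in> borel_measurable lebesgue"
      by (rule measurable_completion) measurable
    then have op_leb: "op_integrand \<rho> u x \<in> borel_measurable lebesgue"
      using ae by (rule borel_measurable_AE)
    have "integrable lebesgue (op_integrand \<rho> u x)"
      using integrable_cong_AE[OF G_leb op_leb ae] G by (simp add: integrable_completion)
    moreover have "op_L \<rho> u x = mass *\<^sub>R u' x - average u' x"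
      using G by (simp add: op_L_def integral_completion flip: integral_cong_AE[OF G_leb op_leb ae])
    ultimately have "(integrable lebesgue (op_integrand \<rho> u x) \<and> op_L \<rho> u x + lam *\<^sub>R u x = f x)
        \<longleftrightarrow> mass *\<^sub>R u' x - average u' x + lam *\<^sub>R u' x = f' x"
      using elim by simp
    also have "\<dots> \<longleftrightarrow> (lam + mass) *\<^sub>R u' x = average u' x + f' x"
      by (auto simp: algebra_simps)
    finally show ?case .
  qed
  then show ?thesis
    unfolding strong_solution_def AE_completion_iff by (rule eventually_cong)
qed

lemma nonneg_kernel_ex_borel:
  fixes \<rho> :: "'a::euclidean_space \<Rightarrow> real"
  assumes int: "integrable lebesgue \<rho>" and nonneg: "AE y in lebesgue. 0 \<le> \<rho> y"
  obtains \<rho>' where "nonneg_kernel \<rho>'" "AE y in lborel. \<rho> y = \<rho>' y"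
proof -
  obtain \<rho>0 where [measurable]: "\<rho>0 \<in> borel_measurable borel" and ae0: "AE y in lborel. \<rho> y = \<rho>0 y"
    using lebesgue_measurable_ex_borel[OF borel_measurable_integrable[OF int]] by blast
  define \<rho>' where "\<rho>' y = max 0 (\<rho>0 y)" for y
  have [measurable]: "\<rho>' \<in> borel_measurable borel"
    unfolding \<rho>'_def[abs_def] by measurable
  have ae: "AE y in lborel. \<rho> y = \<rho>' y"
    using ae0 nonneg[unfolded AE_completion_iff] by eventually_elim (simp add: \<rho>'_def)
  have "integrable lebesgue \<rho>'"
  proof (rule integrable_cong_AE_imp[OF int])
    show "\<rho>' \<in> borel_measurable lebesgue"
      by (rule measurable_completion) measurable
    show "AE y in lebesgue. \<rho> y = \<rho>' y"
      unfolding AE_completion_iff by (rule ae)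
  qed
  then have "nonneg_kernel \<rho>'"
    by unfold_locales (simp_all add: \<rho>'_def integrable_completion)
  then show ?thesis using ae by (rule that)
qed

section \<open>Unique solvability\<close>

theorem theorem2p2:
  fixes \<rho> :: "real^'n \<Rightarrow> real"
  assumes "integrable lebesgue \<rho>"
    and "AE y in lebesgue. 0 \<le> \<rho> y"
  shows "\<exists>C>0. \<forall>lam>0. \<forall>f :: real^'n \<Rightarrow> real^'n. square_integrable f \<longrightarrow>
    (\<exists>u. square_integrable u \<and> strong_solution \<rho> lam f u \<and>
         (\<forall>v. square_integrable v \<and> strong_solution \<rho> lam f v \<longrightarrow> (AE x in lebesgue. v x = u x)) \<and>
         lam * L2_norm u \<le> C * L2_norm f)"
proof -
  obtain \<rho>' where kernel: "nonneg_kernel \<rho>'" and \<rho>': "AE y in lborel. \<rho> y = \<rho>' y"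
    using nonneg_kernel_ex_borel[OF assms] .
  interpret nonneg_kernel \<rho>' by (rule kernel)
  note solution_iff = strong_solution_iff_average[OF kernel \<rho>']
  show ?thesis
  proof (intro exI[of _ "1::real"] conjI allI impI)
    fix lam :: real and f :: "real^'n \<Rightarrow> real^'n"
    assume lam: "0 < lam" and f: "square_integrable f"
    obtain f' where f': "borel_L2 f'" "AE x in lborel. f x = f' x"
      using square_integrable_ex_borel[OF f] .
    obtain u where u: "borel_L2 u" "AE x in lborel. (lam + mass) *\<^sub>R u x = average u x + f' x"
      using resolvent_exists[OF f'(1) lam] .
    have u_leb: "square_integrable u"
      by (rule borel_L2_imp_square_integrable[OF u(1)])
    moreover have "strong_solution \<rho> lam f u"
      using solution_iff[OF u(1) _ f'(2)] u(2) by simp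
    moreover have "AE x in lebesgue. v x = u x"
      if v: "square_integrable v \<and> strong_solution \<rho> lam f v" for v
    proof -
      obtain v' where v': "borel_L2 v'" "AE x in lborel. v x = v' x"
        using square_integrable_ex_borel v by blast
      have "AE x in lborel. (lam + mass) *\<^sub>R v' x = average v' x + f' x"
        using solution_iff[OF v' f'(2)] v by simp
      then have "AE x in lborel. v' x = u x"
        using resolvent_unique[OF v'(1) u(1) lam] u(2) by blast
      with v'(2) show ?thesis
        unfolding AE_completion_iff by eventually_elim simp
    qed
    moreover have "lam * L2_norm u \<le> 1 * L2_norm f"
    proof -
      have "lam * L2_norm u = sqrt (lam\<^sup>2 * (LINT x|lborel. (norm (u x))\<^sup>2))"
        using L2_norm_eq_borel[OF _ u(1)] u_leb lam
        by (simp add: square_integrable_def real_sqrt_mult)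
      also have "\<dots> \<le> sqrt (LINT x|lborel. (norm (f' x))\<^sup>2)"
        by (intro real_sqrt_le_mono a_priori_estimate[OF u(1) f'(1) lam u(2)])
      also have "\<dots> = L2_norm f"
        using L2_norm_eq_borel[OF _ f'] f by (simp add: square_integrable_def)
      finally show ?thesis by simp
    qed
    ultimately show "\<exists>u. square_integrable u \<and> strong_solution \<rho> lam f u \<and>
        (\<forall>v. square_integrable v \<and> strong_solution \<rho> lam f v \<longrightarrow> (AE x in lebesgue. v x = u x)) \<and>
        lam * L2_norm u \<le> 1 * L2_norm f"
      by blast
  qed simp
qed

end
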